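(* Let $f:\mathbb{N}\to\mathbb{C}$ be multiplicative and suppose $f(p^a)=0$ for all primes $p$ and all integers $a\ge 2$. Then for every $n\ge1$, $$f^{-1\circ}(n)=(-1)^{\Omega(n)}\xi(n)\prod_p f(p)^{\nu_p(n)}=\lambda(n)\xi(n)\prod_p f(p)^{\nu_p(n)}$$ and $$f^{-1*}(n)=(-1)^{\Omega(n)}\prod_p f(p)^{\nu_p(n)}=\lambda(n)\prod_p f(p)^{\nu_p(n)}.$$
   Context: A function $f:\mathbb{N}\to\mathbb{C}$ is multiplicative if $f(1)=1$ and $f(mn)=f(m)f(n)$ whenever $\gcd(m,n)=1$. For $n\in\mathbb{N}$ write $n=\prod_p p^{\nu_p(n)}$; $\Omega(n)=\sum_p\nu_p(n)$; $\lambda(n)=(-1)^{\Omega(n)}$ (Liouville function); $\xi(n)=\prod_p\nu_p(n)!$. The Dirichlet convolution is $(f*g)(n)=\sum_{d\mid n}f(d)g(n/d)$, the binomial convolution is $(f\circ g)(n)=\sum_{d\mid n}\left(\prod_p\binom{\nu_p(n)}{\nu_p(d)}\right)f(d)g(n/d)$, both with identity $\delta$ ($\delta(1)=1$, $\delta(n)=0$ for $n>1$); $f^{-1\circ}$ and $f^{-1*}$ denote the inverses of $f$ under $\circ$ and $*$ respectively. Convention $0^0=1$. *)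

theory Defs
  imports Complex_Main "HOL-Computational_Algebra.Primes"
begin

text \<open>
  Arithmetic functions live on the positive integers. They are represented by functions on
  \<^typ>\<open>nat\<close>, whose value at \<open>0\<close> never matters. Below, \<open>\<nu>\<^sub>p(n)\<close> is \<open>multiplicity p n\<close>, and a product
  over all primes is taken over \<open>prime_factors n\<close>, since all other factors are \<open>1\<close>.
\<close>

definition multiplicative :: "(nat \<Rightarrow> complex) \<Rightarrow> bool" where
  "multiplicative f \<longleftrightarrow>
     f 1 = 1 \<and> (\<forall>m n. m > 0 \<longrightarrow> n > 0 \<longrightarrow> coprime m n \<longrightarrow> f (m * n) = f m * f n)"

definition big_omega :: "nat \<Rightarrow> nat" where
  "big_omega n = (\<Sum>p\<in>prime_factors n. multiplicity p n)"

definition liouville :: "nat \<Rightarrow> complex" where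
  "liouville n = (-1) ^ big_omega n"

definition xi :: "nat \<Rightarrow> nat" where
  "xi n = (\<Prod>p\<in>prime_factors n. fact (multiplicity p n))"

definition conv_unit :: "nat \<Rightarrow> complex" where
  "conv_unit n = (if n = 1 then 1 else 0)"

definition dirichlet_conv :: "(nat \<Rightarrow> complex) \<Rightarrow> (nat \<Rightarrow> complex) \<Rightarrow> nat \<Rightarrow> complex" where
  "dirichlet_conv f g n = (\<Sum>d | d dvd n. f d * g (n div d))"

definition binomial_conv :: "(nat \<Rightarrow> complex) \<Rightarrow> (nat \<Rightarrow> complex) \<Rightarrow> nat \<Rightarrow> complex" where
  "binomial_conv f g n =
     (\<Sum>d | d dvd n.
        of_nat (\<Prod>p\<in>prime_factors n. multiplicity p n choose multiplicity p d) * f d * g (n div d))"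

text \<open>
  Both convolutions are commutative, so one-sided inverses are two-sided. The inverse is unique
  only on the positive integers; \<open>g 0 = 0\<close> fixes the irrelevant value, so that the descriptions
  below are proper whenever \<open>f 1 \<noteq> 0\<close> (proved below).
\<close>

definition dirichlet_inverse :: "(nat \<Rightarrow> complex) \<Rightarrow> nat \<Rightarrow> complex" where
  "dirichlet_inverse f = (THE g. g 0 = 0 \<and> (\<forall>n>0. dirichlet_conv f g n = conv_unit n))"

definition binomial_inverse :: "(nat \<Rightarrow> complex) \<Rightarrow> nat \<Rightarrow> complex" where
  "binomial_inverse f = (THE g. g 0 = 0 \<and> (\<forall>n>0. binomial_conv f g n = conv_unit n))"

lemma sum_divisors_reflect:
  fixes h :: "nat \<Rightarrow> nat \<Rightarrow> complex"
  assumes "n > 0"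
  shows "(\<Sum>d | d dvd n. h d (n div d)) = (\<Sum>d | d dvd n. h (n div d) d)"
  by (rule sum.reindex_bij_witness[of _ "\<lambda>d. n div d" "\<lambda>d. n div d"])
     (use assms in \<open>auto elim!: dvdE\<close>)

lemma dirichlet_conv_commute:
  assumes "n > 0"
  shows "dirichlet_conv f g n = dirichlet_conv g f n"
  using sum_divisors_reflect[OF assms, of "\<lambda>a b. f a * g b"]
  by (simp add: dirichlet_conv_def mult.commute)

lemma binomial_conv_commute:
  assumes "n > 0"
  shows "binomial_conv f g n = binomial_conv g f n"
proof -
  have w: "(\<Prod>p\<in>prime_factors n. multiplicity p n choose multiplicity p (n div d)) =
           (\<Prod>p\<in>prime_factors n. multiplicity p n choose multiplicity p d)" if "d dvd n" for d
  proof (rule prod.cong[OF refl])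
    fix p assume "p \<in> prime_factors n"
    then have p: "prime_elem p" by auto
    from that obtain e where e: "n = d * e" by (elim dvdE)
    with assms have "d \<noteq> 0" "e \<noteq> 0" by auto
    then have "multiplicity p n = multiplicity p d + multiplicity p e" "n div d = e"
      using p e by (auto simp: prime_elem_multiplicity_mult_distrib)
    then show "multiplicity p n choose multiplicity p (n div d) =
          multiplicity p n choose multiplicity p d"
      using binomial_symmetric[of "multiplicity p d" "multiplicity p n"] by simp
  qed
  have "binomial_conv f g n = (\<Sum>d | d dvd n. of_nat (\<Prod>p\<in>prime_factors n.
          multiplicity p n choose multiplicity p (n div d)) * f (n div d) * g d)"
    unfolding binomial_conv_def
    using sum_divisors_reflect[OF assms, of "\<lambda>a b. of_nat (\<Prod>p\<in>prime_factors n.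
          multiplicity p n choose multiplicity p a) * f a * g b"] .
  also have "\<dots> = binomial_conv g f n"
    unfolding binomial_conv_def by (rule sum.cong) (simp_all add: w ac_simps)
  finally show ?thesis .
qed

lemma ex1_weighted_inverse:
  fixes w :: "nat \<Rightarrow> nat \<Rightarrow> complex" and f u :: "nat \<Rightarrow> complex"
  assumes "f 1 \<noteq> 0" and w1: "\<And>n. n > 0 \<Longrightarrow> w n 1 = 1"
  shows "\<exists>!g. g 0 = 0 \<and> (\<forall>n>0. (\<Sum>d | d dvd n. w n d * f d * g (n div d)) = u n)"
proof -
  define R where "R g n = (\<Sum>d\<in>{d. d dvd n} - {1}. w n d * f d * g (n div d))"
    for g :: "nat \<Rightarrow> complex" and n
  have split: "(\<Sum>d | d dvd n. w n d * f d * g (n div d)) = f 1 * g n + R g n"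
    if "n > 0" for g n
    unfolding R_def using that by (subst sum.remove[of _ 1]) (auto simp: w1[simplified])
  have R_cong: "R g n = R h n" if "n > 0" "\<And>m. m < n \<Longrightarrow> g m = h m" for g h n
    unfolding R_def
  proof (rule sum.cong[OF refl])
    fix d assume d: "d \<in> {d. d dvd n} - {1}"
    with that(1) have "d > 1" by (cases "d = 0") auto
    then show "w n d * f d * g (n div d) = w n d * f d * h (n div d)"
      using that by simp
  qed
  have "\<exists>g. \<forall>n. g n = (if n = 0 then 0 else (u n - R g n) / f 1)"
  proof (rule dependent_wf_choice[OF wf_less])
    fix g h :: "nat \<Rightarrow> complex" and n r
    assume "\<And>m. (m, n) \<in> {(x, y). x < y} \<Longrightarrow> g m = h m"
    then have "n > 0 \<Longrightarrow> R g n = R h n" by (intro R_cong) auto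
    then show "(r = (if n = 0 then 0 else (u n - R g n) / f 1)) \<longleftrightarrow>
               (r = (if n = 0 then 0 else (u n - R h n) / f 1))" by auto
  qed auto
  then obtain g where g: "\<And>n. g n = (if n = 0 then 0 else (u n - R g n) / f 1)" by blast
  show ?thesis
  proof (rule ex1I[of _ g], intro conjI allI impI)
    show "g 0 = 0" by (subst g) simp
    show "(\<Sum>d | d dvd n. w n d * f d * g (n div d)) = u n" if "n > 0" for n
      unfolding split[OF that] by (subst (1) g) (use that assms(1) in auto)
  next
    fix h assume h: "h 0 = 0 \<and> (\<forall>n>0. (\<Sum>d | d dvd n. w n d * f d * h (n div d)) = u n)"
    show "h = g"
    proof
      fix n show "h n = g n"
      proof (induction n rule: less_induct)
        case (less n)
        show ?case
        proof (cases "n = 0")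
          case True
          then show ?thesis using h by (subst g) simp
        next
          case False
          then have "f 1 * h n + R h n = u n" using h split[of n h] by simp
          moreover have "R h n = R g n" using False less by (intro R_cong) auto
          ultimately have "h n = (u n - R g n) / f 1"
            using assms(1) by (simp add: field_simps)
          then show ?thesis using False by (subst g) simp
        qed
      qed
    qed
  qed
qed

lemma ex1_dirichlet_inverse:
  assumes "f 1 \<noteq> 0"
  shows "\<exists>!g. g 0 = 0 \<and> (\<forall>n>0. dirichlet_conv f g n = conv_unit n)"
  using ex1_weighted_inverse[of f "\<lambda>_ _. 1" conv_unit] assms by (simp add: dirichlet_conv_def)

lemma ex1_binomial_inverse:
  assumes "f 1 \<noteq> 0"
  shows "\<exists>!g. g 0 = 0 \<and> (\<forall>n>0. binomial_conv f g n = conv_unit n)"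
  unfolding binomial_conv_def by (rule ex1_weighted_inverse[where f = f, OF assms]) simp

end

theory Submission
  imports Defs
begin

text \<open>
  Fix a prime \<open>p\<close> dividing \<open>n\<close>. As \<open>f\<close> vanishes on every \<open>d\<close> divisible by \<open>p\<^sup>2\<close>, only the divisors
  \<open>e\<close> and \<open>p e\<close> with \<open>p\<close> not dividing \<open>e\<close> contribute to a convolution \<open>\<Sum> w(d) f(d) g(n/d)\<close>. For the
  claimed inverses the contributions of \<open>e\<close> and \<open>p e\<close> cancel, because \<open>g(p k) = - f(p) g(k)\<close> in the
  Dirichlet case, and \<open>g(p k) = - (\<nu>\<^sub>p(k) + 1) f(p) g(k)\<close> in the binomial case, where passing from
  \<open>e\<close> to \<open>p e\<close> multiplies the weight by \<open>\<nu>\<^sub>p(n) = \<nu>\<^sub>p(k) + 1\<close>.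
\<close>

text \<open>Splitting off the full power of \<open>p\<close> in \<open>d\<close> leaves a cofactor
  coprime to it, so \<open>f d\<close> has the factor \<open>f (p ^ multiplicity p d)\<close>, whose
  exponent is at least 2.\<close>

lemma multiplicative_eq_0_of_square_dvd:
  assumes "multiplicative f" and "\<And>a. a \<ge> 2 \<Longrightarrow> f (p ^ a) = 0"
    and "prime p" and "d > 0" and "p\<^sup>2 dvd d"
  shows "f d = 0"
proof -
  obtain e where e: "d = p ^ multiplicity p d * e" "\<not> p dvd e"
    using multiplicity_decompose'[of d p] assms by (metis not_prime_unit less_numeral_extra(3))
  have "multiplicity p d \<ge> 2"
    using assms by (intro multiplicity_geI) auto
  moreover have "coprime (p ^ multiplicity p d) e"
    using e(2) assms(3) by (simp add: prime_imp_coprime)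
  moreover have "e > 0" "p > 0"
    using e(2) assms(3) by (auto intro!: Nat.gr0I)
  ultimately show ?thesis
    using assms(1,2) e(1) unfolding multiplicative_def by (metis mult_zero_left zero_less_power)
qed

text \<open>The weight \<open>w\<close> stays arbitrary so that both convolutions are covered:
  \<open>w\<close> is constantly 1 for Dirichlet and the product of binomial coefficients otherwise.
  The assumption \<open>cancel\<close> is the joint contribution of \<open>e\<close> and
  \<open>p * e\<close> with the common factor \<open>f e\<close> removed.\<close>

lemma weighted_conv_eq_0:
  fixes w g :: "nat \<Rightarrow> complex"
  assumes f: "multiplicative f" "\<And>a. a \<ge> 2 \<Longrightarrow> f (p ^ a) = 0"
    and p: "prime p" "p dvd n" and n: "n > 0"
    and cancel: "\<And>e k. n = p * e * k \<Longrightarrow> \<not> p dvd e \<Longrightarrow> w e * g (p * k) + w (p * e) * f p * g k = 0"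
  shows "(\<Sum>d | d dvd n. w d * f d * g (n div d)) = 0"
proof -
  define t where "t d = w d * f d * g (n div d)" for d
  define A where "A = {e. e dvd n \<and> \<not> p dvd e}"
  have fin: "finite {d. d dvd n}" using n by simp
  have finA: "finite A" unfolding A_def by (rule finite_subset[OF _ fin]) auto
  have p0: "p > 0" using p(1) by (rule prime_gt_0_nat)
  have mult_dvd: "p * e dvd n" if "e \<in> A" for e
    using that p by (auto simp: A_def intro!: divides_mult prime_imp_coprime)
  \<comment> \<open>Not being in \<open>A\<close> forces \<open>d = p * e\<close>, and not being in
    the image of \<open>A\<close> forces \<open>p\<close> to divide \<open>e\<close> as
    well.\<close>
  have t0: "t d = 0" if "d dvd n" "d \<notin> A" "d \<notin> (*) p ` A" for d
  proof -
    from that obtain e where e: "d = p * e" by (auto simp: A_def)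
    have "p dvd e" using that e by (auto simp: A_def intro: dvd_mult_right)
    then have "p\<^sup>2 dvd d" using e by (simp add: power2_eq_square)
    moreover have "d > 0" using that(1) n by (auto intro: dvd_pos_nat)
    ultimately show ?thesis
      using multiplicative_eq_0_of_square_dvd[OF f p(1)] by (simp add: t_def)
  qed
  have "(\<Sum>d | d dvd n. t d) = (\<Sum>d\<in>A \<union> (*) p ` A. t d)"
    by (rule sum.mono_neutral_right[OF fin]) (use mult_dvd t0 in \<open>auto simp: A_def\<close>)
  also have "\<dots> = (\<Sum>e\<in>A. t e) + (\<Sum>d\<in>(*) p ` A. t d)"
    by (rule sum.union_disjoint) (use finA in \<open>auto simp: A_def\<close>)
  also have "(\<Sum>d\<in>(*) p ` A. t d) = (\<Sum>e\<in>A. t (p * e))"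
    using p0 by (subst sum.reindex) (auto simp: inj_on_def)
  also have "(\<Sum>e\<in>A. t e) + (\<Sum>e\<in>A. t (p * e)) = (\<Sum>e\<in>A. t e + t (p * e))"
    by (simp add: sum.distrib)
  also have "\<dots> = 0"
  proof (rule sum.neutral, intro ballI)
    fix e assume e: "e \<in> A"
    from mult_dvd[OF e] obtain k where k: "n = p * e * k" by (elim dvdE)
    have ne: "\<not> p dvd e" and e0: "e > 0" using e by (auto simp: A_def intro!: Nat.gr0I)
    have "f (p * e) = f p * f e"
      using f(1) p0 e0 ne p(1) by (simp add: multiplicative_def prime_imp_coprime)
    moreover have "n div e = p * k" "n div (p * e) = k"
      using k e0 p0 by (simp_all add: mult.commute mult.left_commute)
    ultimately have "t e + t (p * e) = f e * (w e * g (p * k) + w (p * e) * f p * g k)"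
      by (simp add: t_def algebra_simps)
    then show "t e + t (p * e) = 0" using cancel[OF k ne] by simp
  qed
  finally show ?thesis by (simp add: t_def)
qed

text \<open>Only the local factor at \<open>p\<close> changes between \<open>k\<close> and
  \<open>p * k\<close>. As \<open>p\<close> may fail to divide \<open>k\<close>, \<open>c0\<close>
  supplies the trivial factor that lets both products run over the same primes.\<close>

lemma prod_prime_factors_times_prime:
  fixes c :: "nat \<Rightarrow> nat \<Rightarrow> 'a :: comm_semiring_1"
  assumes c0: "\<And>q. c q 0 = 1" and p: "prime p" and "k > 0"
    and step: "c p (Suc (multiplicity p k)) = s * c p (multiplicity p k)"
  shows "(\<Prod>q\<in>prime_factors (p * k). c q (multiplicity q (p * k))) =
         s * (\<Prod>q\<in>prime_factors k. c q (multiplicity q k))"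
proof -
  have p0: "p > 0" using p by (rule prime_gt_0_nat)
  let ?S = "insert p (prime_factors k)"
  have pf: "prime_factors (p * k) = ?S"
    using assms p0 by (simp add: prime_factors_product prime_prime_factors)
  have mp: "multiplicity p (p * k) = Suc (multiplicity p k)"
    using assms p0 by (intro multiplicity_times_same) (auto dest: not_prime_unit)
  have mq: "multiplicity q (p * k) = multiplicity q k" if "q \<in> ?S - {p}" for q
    using that p by (auto simp: in_prime_factors_iff intro!: multiplicity_prime_elem_times_other
        dest: primes_dvd_imp_eq)
  have "(\<Prod>q\<in>prime_factors k. c q (multiplicity q k)) = (\<Prod>q\<in>?S. c q (multiplicity q k))"
    by (rule prod.mono_neutral_left)
       (use p c0 \<open>k > 0\<close> in \<open>auto simp: in_prime_factors_iff not_dvd_imp_multiplicity_0\<close>)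
  also have "\<dots> = c p (multiplicity p k) * (\<Prod>q\<in>?S - {p}. c q (multiplicity q k))"
    by (rule prod.remove) auto
  finally show ?thesis
    unfolding pf by (subst prod.remove[of _ p]) (auto simp: mp mq step mult.assoc)
qed

text \<open>The factor at \<open>p\<close> changes from \<open>multiplicity p n choose 0\<close>,
  which is 1, to \<open>multiplicity p n choose 1\<close>; all others stay.\<close>

lemma binomial_weight_times_prime:
  fixes p e n :: nat
  assumes p: "prime p" "\<not> p dvd e" and "p dvd n" "n > 0"
  shows "(\<Prod>q\<in>prime_factors n. multiplicity q n choose multiplicity q (p * e)) =
         multiplicity p n * (\<Prod>q\<in>prime_factors n. multiplicity q n choose multiplicity q e)"
proof -
  have e0: "e > 0" "p > 0" using p by (auto intro!: Nat.gr0I)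
  have pin: "p \<in> prime_factors n" using assms by (simp add: in_prime_factors_iff)
  have "multiplicity p e = 0" using p(2) by (rule not_dvd_imp_multiplicity_0)
  moreover from this have "multiplicity p (p * e) = 1"
    using p e0 by (subst multiplicity_times_same) (auto dest: not_prime_unit)
  moreover have "multiplicity q (p * e) = multiplicity q e" if "q \<in> prime_factors n - {p}" for q
    using that p by (auto simp: in_prime_factors_iff intro!: multiplicity_prime_elem_times_other
        dest: primes_dvd_imp_eq)
  ultimately show ?thesis
    using pin by (simp add: prod.remove[of _ p])
qed

text \<open>The description defining the inverse demands the value 0 at 0. Resetting
  \<open>g\<close> there is harmless, since \<open>n div d\<close> is positive for every divisor
  \<open>d\<close> of a positive \<open>n\<close>.\<close>

lemma dirichlet_inverse_eqI:
  assumes "f 1 \<noteq> 0" and "n > 0" and "\<And>n. n > 0 \<Longrightarrow> dirichlet_conv f g n = conv_unit n"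
  shows "dirichlet_inverse f n = g n"
proof -
  have "dirichlet_conv f (g(0 := 0)) n = dirichlet_conv f g n" if "n > 0" for n
    unfolding dirichlet_conv_def using that by (intro sum.cong) (auto elim!: dvdE)
  then have "dirichlet_inverse f = g(0 := 0)"
    unfolding dirichlet_inverse_def
    using assms(1,3) by (intro the1_equality ex1_dirichlet_inverse) auto
  then show ?thesis using assms(2) by simp
qed

lemma binomial_inverse_eqI:
  assumes "f 1 \<noteq> 0" and "n > 0" and "\<And>n. n > 0 \<Longrightarrow> binomial_conv f g n = conv_unit n"
  shows "binomial_inverse f n = g n"
proof -
  have "binomial_conv f (g(0 := 0)) n = binomial_conv f g n" if "n > 0" for n
    unfolding binomial_conv_def using that by (intro sum.cong) (auto elim!: dvdE)
  then have "binomial_inverse f = g(0 := 0)"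
    unfolding binomial_inverse_def
    using assms(1,3) by (intro the1_equality ex1_binomial_inverse) auto
  then show ?thesis using assms(2) by simp
qed

theorem theorem2p3:
  fixes f :: "nat \<Rightarrow> complex" and n :: nat
  assumes "multiplicative f"
    and "\<And>p a :: nat. prime p \<Longrightarrow> a \<ge> 2 \<Longrightarrow> f (p ^ a) = 0"
    and "n \<ge> 1"
  shows "binomial_inverse f n =
           (-1) ^ big_omega n * of_nat (xi n) * (\<Prod>p\<in>prime_factors n. f p ^ multiplicity p n)
       \<and> binomial_inverse f n =
           liouville n * of_nat (xi n) * (\<Prod>p\<in>prime_factors n. f p ^ multiplicity p n)
       \<and> dirichlet_inverse f n =
           (-1) ^ big_omega n * (\<Prod>p\<in>prime_factors n. f p ^ multiplicity p n)
       \<and> dirichlet_inverse f n =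
           liouville n * (\<Prod>p\<in>prime_factors n. f p ^ multiplicity p n)"
proof -
  \<comment> \<open>In \<open>g\<close> and \<open>h\<close> the sign is absorbed into the base
    \<open>- f p\<close>, which makes both pure products of local factors; \<open>g_eq\<close> and
    \<open>h_eq\<close> recover the stated forms.\<close>
  define g where "g n = (\<Prod>p\<in>prime_factors n. (- f p) ^ multiplicity p n)" for n
  define h where "h n = (\<Prod>p\<in>prime_factors n. fact (multiplicity p n) * (- f p) ^ multiplicity p n)"
    for n
  have f1: "f 1 = 1" using assms(1) by (simp add: multiplicative_def)
  have g_times: "g (p * k) = - f p * g k" if "prime p" "k > 0" for p k
    unfolding g_def using that by (intro prod_prime_factors_times_prime) auto
  \<comment> \<open>The extra factor comes from
    \<open>fact (Suc a) = Suc a * fact a\<close>.\<close>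
  have h_times: "h (p * k) = - (of_nat (Suc (multiplicity p k)) * f p) * h k"
    if "prime p" "k > 0" for p k
    unfolding h_def using that
    by (intro prod_prime_factors_times_prime[where c = "\<lambda>q a. fact a * (- f q) ^ a"])
       (auto simp: algebra_simps)
  have "dirichlet_conv f g m = conv_unit m" if m: "m > 0" for m
  proof (cases "m = 1")
    case True
    then show ?thesis using f1 by (simp add: dirichlet_conv_def conv_unit_def g_def)
  next
    case False
    then obtain p where p: "prime p" "p dvd m" using prime_factor_nat by blast
    have "(\<Sum>d | d dvd m. 1 * f d * g (m div d)) = 0"
      using m assms(2)
      by (intro weighted_conv_eq_0[OF assms(1) _ p m]) (auto simp: g_times p(1))
    then show ?thesis using False by (simp add: dirichlet_conv_def conv_unit_def)
  qed
  then have dir: "dirichlet_inverse f n = g n"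
    using f1 assms(3) by (intro dirichlet_inverse_eqI) auto
  have "binomial_conv f h m = conv_unit m" if m: "m > 0" for m
  proof (cases "m = 1")
    case True
    then show ?thesis using f1 by (simp add: binomial_conv_def conv_unit_def h_def)
  next
    case False
    then obtain p where p: "prime p" "p dvd m" using prime_factor_nat by blast
    have "binomial_conv f h m = 0"
      unfolding binomial_conv_def
    proof (rule weighted_conv_eq_0[OF assms(1) _ p m])
      fix e k assume mek: "m = p * e * k" and e: "\<not> p dvd e"
      have pos: "p > 0" "e > 0" "k > 0" using m mek by auto
      \<comment> \<open>This identifies the factor gained by the binomial weight with the one gained
        by \<open>h (p * k)\<close>, so the two terms differ only in sign.\<close>
      then have "multiplicity p m = Suc (multiplicity p k)"
        using mek p(1) e multiplicity_times_same[of p "e * k"]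
        by (simp add: prime_elem_multiplicity_mult_distrib not_dvd_imp_multiplicity_0 mult.assoc)
      then show "of_nat (\<Prod>q\<in>prime_factors m. multiplicity q m choose multiplicity q e) * h (p * k) +
          of_nat (\<Prod>q\<in>prime_factors m. multiplicity q m choose multiplicity q (p * e)) * f p * h k = 0"
        unfolding h_times[OF p(1) pos(3)] binomial_weight_times_prime[OF p(1) e p(2) m]
        by (simp only: of_nat_mult) (simp add: algebra_simps)
    qed (use assms(2) p in auto)
    then show ?thesis using False by (simp add: conv_unit_def)
  qed
  then have bin: "binomial_inverse f n = h n"
    using f1 assms(3) by (intro binomial_inverse_eqI) auto
  have g_eq: "g n = (-1) ^ big_omega n * (\<Prod>p\<in>prime_factors n. f p ^ multiplicity p n)"
    unfolding g_def big_omega_def power_sum prod.distrib[symmetric]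
    by (simp add: power_minus[of "f _"])
  have h_eq: "h n = of_nat (xi n) * g n"
    unfolding h_def g_def xi_def by (simp add: prod.distrib)
  show ?thesis
    unfolding dir bin h_eq g_eq liouville_def by (simp add: ac_simps)
qed

end
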